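(* Let $\mathcal{P}=(p_1,p_2,\dots)$ be a probability distribution on $\mathbb{N}$ with $p_1\ge p_2\ge p_3\ge\cdots$ and with unbounded support, let $Q_k=\sum_{j=k+1}^\infty p_j$, and consider the Damaged Bits (DB) model with distribution $\mathcal{P}$. (i) If $\limsup_{k\to\infty}\frac{Q_{k+1}}{Q_k}=p<1$, then the DB model is recurrent. (ii) If $p_k\sim C\exp(-\alpha k^\gamma)$ as $k\to\infty$ for some $C>0$, $\alpha>0$ and $\gamma\in(0,1/2)$, then the DB model is transient.
   Context: $\mathbb{N}=\{1,2,\dots\}$; $a_k\sim b_k$ means $a_k/b_k\to1$ as $k\to\infty$. Damaged Bits (DB) model: let $\chi_1,\chi_2,\dots$ be i.i.d. random variables with $\mathbf{P}(\chi_i=k)=p_k$, $k\in\mathbb{N}$. The DB model is the discrete-time Markov chain $\zeta_n=(\zeta_n^1,\zeta_n^2,\dots)$, $n\ge 0$, with values in $\mathcal{Y}=\{y\in\{0,1,2\}^{\mathbb{N}}: y\text{ has finitely many non-zeros}\}$, started from $\zeta_0=\mathbf{0}=(0,0,\dots)$, with $$\zeta^k_{n+1}=\begin{cases}\zeta^k_n,& k\ne\chi_{n+1},\\ \min\{2,1+\zeta^k_n\},& k=\chi_{n+1},\end{cases}\qquad k\in\mathbb{N},\ n\ge 0.$$ The states $0,1,2$ of a bit encode idle, active and damaged respectively. The return time to the ground state (no active bits) is $\tau_{\mathrm{DB}}=\min\{n\ge1:\zeta_n^k\in\{0,2\}\ \text{for all }k\in\mathbb{N}\}$, with $\tau_{\mathrm{DB}}=\infty$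 if no such $n$ exists. The DB model is called recurrent if $\mathbf{P}(\tau_{\mathrm{DB}}<\infty)=1$, and transient otherwise. *)

theory Defs
  imports "HOL-Probability.Probability" "HOL-Library.Landau_Symbols"
begin

text \<open>
  Bits and time steps are indexed by \<open>1, 2, \<dots>\<close> inside the type \<^typ>\<open>nat\<close>. A distribution on
  these indices is a \<^typ>\<open>nat pmf\<close> that gives no mass to \<open>0\<close>, with \<open>p\<^sub>k\<close> written \<open>pmf P k\<close>.
\<close>

definition tail_sum :: "nat pmf \<Rightarrow> nat \<Rightarrow> real" where
  "tail_sum P k = (\<Sum>j. pmf P (k + 1 + j))"

text \<open>
  The driving i.i.d. sequence \<open>\<xi>\<close> starts at time \<open>1\<close>; the value \<open>\<xi> 0\<close> is unconstrained
  and never used.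
\<close>

locale damaged_bits = prob_space M
  for M :: "'a measure" and P :: "nat pmf" and \<xi> :: "nat \<Rightarrow> 'a \<Rightarrow> nat" +
  assumes no_mass_0: "0 \<notin> set_pmf P"
    and indep: "indep_vars (\<lambda>_. count_space UNIV) \<xi> {1..}"
    and law: "\<And>i k. 1 \<le> i \<Longrightarrow> prob {\<omega> \<in> space M. \<xi> i \<omega> = k} = pmf P k"

text \<open>
  \<open>db_state \<xi> n \<omega> k\<close> is the state of bit \<open>k\<close> at time \<open>n\<close>, encoded as
  \<open>0\<close> (idle), \<open>1\<close> (active) or \<open>2\<close> (damaged).
\<close>

primrec db_state :: "(nat \<Rightarrow> 'a \<Rightarrow> nat) \<Rightarrow> nat \<Rightarrow> 'a \<Rightarrow> nat \<Rightarrow> nat" where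
  "db_state \<xi> 0 \<omega> = (\<lambda>k. 0)"
| "db_state \<xi> (Suc n) \<omega> =
     (\<lambda>k. if k = \<xi> (Suc n) \<omega> then min 2 (1 + db_state \<xi> n \<omega> k) else db_state \<xi> n \<omega> k)"

text \<open>The infimum of the empty set in \<^typ>\<open>enat\<close> is \<open>\<infinity>\<close>.\<close>

definition db_return_time :: "(nat \<Rightarrow> 'a \<Rightarrow> nat) \<Rightarrow> 'a \<Rightarrow> enat" where
  "db_return_time \<xi> \<omega> = Inf {enat n |n. 1 \<le> n \<and> (\<forall>k\<ge>1. db_state \<xi> n \<omega> k \<in> {0, 2})}"

definition db_recurrent :: "'a measure \<Rightarrow> (nat \<Rightarrow> 'a \<Rightarrow> nat) \<Rightarrow> bool" where
  "db_recurrent M \<xi> \<longleftrightarrow> measure M {\<omega> \<in> space M. db_return_time \<xi> \<omega> < \<infinity>} = 1"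

definition db_transient :: "'a measure \<Rightarrow> (nat \<Rightarrow> 'a \<Rightarrow> nat) \<Rightarrow> bool" where
  "db_transient M \<xi> \<longleftrightarrow> \<not> db_recurrent M \<xi>"

lemma db_state_space:
  "db_state \<xi> n \<omega> k \<in> {0, 1, 2}" "finite {k. db_state \<xi> n \<omega> k \<noteq> 0}"
proof -
  show "db_state \<xi> n \<omega> k \<in> {0, 1, 2}"
    by (induction n) auto
  show "finite {k. db_state \<xi> n \<omega> k \<noteq> 0}"
  proof (induction n)
    case (Suc n)
    have "{k. db_state \<xi> (Suc n) \<omega> k \<noteq> 0} \<subseteq> insert (\<xi> (Suc n) \<omega>) {k. db_state \<xi> n \<omega> k \<noteq> 0}"
      by auto
    with Suc show ?case
      by (meson finite_insert finite_subset)
  qed simp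
qed

lemma db_return_time_finite_iff:
  "db_return_time \<xi> \<omega> < \<infinity> \<longleftrightarrow> (\<exists>n\<ge>1. \<forall>k\<ge>1. db_state \<xi> n \<omega> k \<in> {0, 2})"
  unfolding db_return_time_def Inf_less_iff by auto

context damaged_bits
begin

lemma measurable_xi: "1 \<le> i \<Longrightarrow> \<xi> i \<in> measurable M (count_space UNIV)"
  using indep unfolding indep_vars_def by auto

lemma measurable_db_state:
  "(\<lambda>\<omega>. db_state \<xi> n \<omega> k) \<in> measurable M (count_space UNIV)"
proof (induction n)
  case (Suc n)
  let ?S = "{\<omega> \<in> space M. \<xi> (Suc n) \<omega> = k}"
  have "?S = \<xi> (Suc n) -` {k} \<inter> space M" by auto
  then have S: "?S \<in> sets M"
    using measurable_sets[OF measurable_xi[of "Suc n"], of "{k}"] by simp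
  have min: "(\<lambda>\<omega>. min 2 (1 + db_state \<xi> n \<omega> k)) \<in> measurable M (count_space UNIV)"
    by (rule measurable_compose[OF Suc]) simp
  have "(\<lambda>\<omega>. if \<xi> (Suc n) \<omega> = k then min 2 (1 + db_state \<xi> n \<omega> k) else db_state \<xi> n \<omega> k)
      \<in> measurable M (count_space UNIV)"
    by (rule measurable_If[OF min Suc S])
  then show ?case by (simp add: eq_commute[of k])
qed simp

lemma db_return_event: "{\<omega> \<in> space M. db_return_time \<xi> \<omega> < \<infinity>} \<in> events"
proof -
  have "{\<omega> \<in> space M. db_state \<xi> n \<omega> k \<in> {0, 2}} \<in> events" for n k
  proof -
    have "{\<omega> \<in> space M. db_state \<xi> n \<omega> k \<in> {0, 2}} = (\<lambda>\<omega>. db_state \<xi> n \<omega> k) -` {0, 2} \<inter> space M"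
      by auto
    then show ?thesis
      using measurable_sets[OF measurable_db_state, of "{0, 2}"] by simp
  qed
  then have "{\<omega> \<in> space M. \<exists>n\<in>{1..}. \<forall>k\<in>{1..}. db_state \<xi> n \<omega> k \<in> {0, 2}} \<in> events"
    by (intro sets.sets_Collect_countable_Bex sets.sets_Collect_countable_Ball) auto
  then show ?thesis
    unfolding db_return_time_finite_iff by (simp only: Bex_def Ball_def atLeast_iff)
qed

end

end

theory Submission
  imports Defs "HOL-Real_Asymp.Real_Asymp"
begin

text \<open>
  A bit is active exactly when its index occurs once among the letters drawn so far, so the model
  is in a ground state at time \<open>n\<close> when the word of the first \<open>n\<close> letters has no letter of
  multiplicity one. Let \<open>q n\<close> be the probability of this event.

  The counts of different letters in a word of fixed length are dependent, but they become
  independent Poisson variables when the length itself is Poisson distributed with mean \<open>t\<close>.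
  This gives the identity (\<open>poissonization\<close>)
  \<open>(\<Sum>n. t ^ n / n! * exp (- t) * q n) = (\<Prod>k. 1 - t * p k * exp (- t * p k))\<close>, proved here for
  finite products by a recursion on the first letter. It is used in both directions: a single
  summand bounds \<open>q n\<close> from above by the product at \<open>t = n\<close>, up to the factor \<open>e * n\<close> from
  Stirling's formula (\<open>prob_avoiding_le\<close>); and a lower bound on the product that is uniform in
  \<open>t\<close> keeps \<open>q n\<close> from being eventually small (\<open>prob_avoiding_frequently_ge\<close>).

  Recurrence. If \<open>Q (k + 1) \<le> r * Q k\<close> from some \<open>K\<close> on, with \<open>r < 1\<close>, then a sum of
  \<open>t * p k * exp (- t * p k)\<close> is dominated by a telescoping sum of
  \<open>exp (- (1 - r) * t * Q k)\<close>. Hence the mean number of active bits is bounded in \<open>t\<close>, the product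
  is bounded below, and \<open>q n \<ge> c > 0\<close> for infinitely many \<open>n\<close>. The chain never returns to its
  initial state, so this alone does not yield a return. However, every letter already drawn will
  be drawn at least twice more, and from then on the past does not influence which bits are
  active. After any finite past the conditional probability of a later return is therefore at
  least \<open>c\<close>, and the probability \<open>l\<close> of no return satisfies \<open>l \<le> (1 - c) * l\<close>
  (\<open>nonreturning_prob_tendsto_0\<close>).

  Transience. For \<open>p k \<sim> C * exp (- \<alpha> * k powr \<gamma>)\<close> about \<open>ln n powr (1 / \<gamma> - 1)\<close> bits have
  \<open>n * p k\<close> of order one. The exponent exceeds \<open>1\<close> because \<open>\<gamma> < 1/2\<close>, so \<open>q n\<close> decays faster
  than every power of \<open>n\<close> and is summable. Hence with positive probability there is no return
  after some time \<open>n\<close>, while some letter occurs once among the first \<open>n\<close>. Exchanging that letter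
  with the very first one preserves the distribution and produces a word in which the first
  letter keeps its bit active until time \<open>n\<close>: no return at all (\<open>nonreturning_prob_ge\<close>).
\<close>

section \<open>Words of independent letters and their generating function\<close>

lemma measure_bind_pmf_expectation:
  "measure_pmf.prob (bind_pmf p f) X = measure_pmf.expectation p (\<lambda>x. measure_pmf.prob (f x) X)"
proof -
  have "ennreal (measure_pmf.prob (bind_pmf p f) X) = (\<integral>\<^sup>+x. ennreal (measure_pmf.prob (f x) X) \<partial>p)"
    by (simp add: measure_pmf.emeasure_eq_measure[symmetric])
  also have "\<dots> = ennreal (measure_pmf.expectation p (\<lambda>x. measure_pmf.prob (f x) X))"
    by (intro nn_integral_eq_integral measure_pmf.integrable_const_bound[where B=1]) auto
  finally show ?thesis
    by (subst (asm) ennreal_inj) (auto intro: Bochner_Integration.integral_nonneg)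
qed

text \<open>
  The second set enters through the recursion on the first letter \<open>x\<close> of a word: if \<open>x\<close> must not
  have multiplicity one, then the remaining word must not leave \<open>x\<close> untouched.
\<close>
definition avoiding :: "'b set \<Rightarrow> 'b set \<Rightarrow> 'b list set" where
  "avoiding A U = {xs. (\<forall>k\<in>A. count (mset xs) k \<noteq> 1) \<and> (\<forall>k\<in>U. count (mset xs) k = 0)}"

lemma prob_replicate_Suc:
  "measure_pmf.prob (replicate_pmf (Suc n) P) X =
     measure_pmf.expectation P (\<lambda>x. measure_pmf.prob (replicate_pmf n P) {xs. x # xs \<in> X})"
  by (simp add: measure_bind_pmf_expectation map_pmf_def[symmetric] vimage_def)

text \<open>
  Conditioning on the first letter \<open>x\<close>. A letter of \<open>U\<close> is excluded; a letter of \<open>A\<close> loses its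
  own condition but has to occur again in the remaining word, which is the difference of two
  events of the same kind; every other letter changes nothing.
\<close>
lemma prob_avoiding_Suc:
  fixes P :: "'b pmf"
  defines "e \<equiv> \<lambda>n A U. measure_pmf.prob (replicate_pmf n P) (avoiding A U)"
  assumes fin: "finite A" "finite U" and disj: "A \<inter> U = {}"
  shows "e (Suc n) A U = (1 - sum (pmf P) A - sum (pmf P) U) * e n A U +
           (\<Sum>k\<in>A. pmf P k * (e n (A - {k}) U - e n (A - {k}) (insert k U)))"
proof -
  define d where "d k = e n (A - {k}) U - e n (A - {k}) (insert k U)" for k
  have letter: "measure_pmf.prob (replicate_pmf n P) {xs. x # xs \<in> avoiding A U} =
      e n A U + (\<Sum>k\<in>A. indicator {k} x * (d k - e n A U)) - (\<Sum>k\<in>U. indicator {k} x * e n A U)"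
    (is "?L = ?R") for x
  proof -
    have sums: "?R = e n A U + (if x \<in> A then d x - e n A U else 0) - (if x \<in> U then e n A U else 0)"
      using fin by (simp add: indicator_def of_bool_def if_distrib[of "\<lambda>z. z * _"] eq_commute[of x]
          sum.delta cong: if_cong)
    consider "x \<in> U" "x \<notin> A" | "x \<in> A" "x \<notin> U" | "x \<notin> A" "x \<notin> U"
      using disj by blast
    then show ?thesis
    proof cases
      case 1
      then have "{xs. x # xs \<in> avoiding A U} = {}"
        by (auto simp: avoiding_def)
      with 1 show ?thesis unfolding sums by simp
    next
      case 2
      then have "{xs. x # xs \<in> avoiding A U} = avoiding (A - {x}) U - avoiding (A - {x}) (insert x U)"
        by (auto simp: avoiding_def split: if_splits)
      then have "?L = d x"
        unfolding d_def e_def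
        by (simp add: measure_pmf.finite_measure_Diff avoiding_def subset_iff)
      with 2 show ?thesis unfolding sums by simp
    next
      case 3
      then have "{xs. x # xs \<in> avoiding A U} = avoiding A U"
        by (auto simp: avoiding_def)
      with 3 show ?thesis unfolding sums by (simp add: e_def)
    qed
  qed
  have int: "integrable (measure_pmf P) (indicat_real {k})" for k
    by (intro measure_pmf.integrable_const_bound[where B=1]) (auto simp: indicator_def)
  have "e (Suc n) A U = e n A U + (\<Sum>k\<in>A. pmf P k * (d k - e n A U)) - (\<Sum>k\<in>U. pmf P k * e n A U)"
    unfolding e_def prob_replicate_Suc letter[unfolded e_def]
    using int by (simp add: measure_pmf_single)
  then show ?thesis
    unfolding d_def by (simp add: algebra_simps sum.distrib sum_subtractf sum_distrib_right)
qed

text \<open>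
  The exponential generating function in the word length. Each letter contributes a factor
  \<open>exp (p X)\<close> with the forbidden terms removed: the linear term for a letter in \<open>A\<close> and all but
  the constant term for a letter in \<open>U\<close>. The factors of all letters multiply to \<open>exp X\<close>, which
  remains well defined for infinitely many letters and is split off in front.
\<close>
definition word_egf :: "'b pmf \<Rightarrow> 'b set \<Rightarrow> 'b set \<Rightarrow> real fps" where
  "word_egf P A U = fps_exp 1 * (\<Prod>k\<in>A. 1 - fps_const (pmf P k) * fps_X * fps_exp (- pmf P k))
     * (\<Prod>k\<in>U. fps_exp (- pmf P k))"

lemma word_egf_insert:
  assumes "finite A" "a \<notin> A"
  shows "word_egf P (insert a A) U =
    (1 - fps_const (pmf P a) * fps_X * fps_exp (- pmf P a)) * word_egf P A U"
  using assms by (simp add: word_egf_def algebra_simps)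

lemma word_egf_insert_untouched:
  assumes "finite U" "a \<notin> U"
  shows "word_egf P A (insert a U) = fps_exp (- pmf P a) * word_egf P A U"
  using assms by (simp add: word_egf_def algebra_simps)

text \<open>
  The recursion of \<open>prob_avoiding_Suc\<close> in terms of generating functions: differentiation shifts
  the word length by one.
\<close>
lemma fps_deriv_word_egf:
  assumes "finite A" "finite U"
  shows "fps_deriv (word_egf P A U) =
    fps_const (1 - sum (pmf P) A - sum (pmf P) U) * word_egf P A U +
    (\<Sum>k\<in>A. fps_const (pmf P k) * (1 - fps_exp (- pmf P k)) * word_egf P (A - {k}) U)"
  using assms(1)
proof (induction A)
  case empty
  have "(\<Prod>k\<in>U. fps_exp (- pmf P k)) = fps_exp (- sum (pmf P) U)"
    using assms(2)
    by (induction U) (simp_all flip: fps_exp_add_mult)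
  then have "word_egf P {} U = fps_exp (1 - sum (pmf P) U)"
    by (simp add: word_egf_def flip: fps_exp_add_mult)
  then show ?case by simp
next
  case (insert a A)
  let ?p = "fps_const (pmf P a)" and ?E = "fps_exp (- pmf P a)"
  let ?f = "1 - ?p * fps_X * ?E"
  let ?r = "\<lambda>k. fps_const (pmf P k) * (1 - fps_exp (- pmf P k))"
  have df: "fps_deriv ?f = - (?p * ?E) + ?p * ?p * fps_X * ?E"
    by (simp add: algebra_simps flip: fps_const_neg)
  have ins: "word_egf P (insert a A - {k}) U = ?f * word_egf P (A - {k}) U" if "k \<in> A" for k
  proof -
    have "insert a A - {k} = insert a (A - {k})" using insert.hyps that by auto
    then show ?thesis using insert.hyps by (simp add: word_egf_insert)
  qed
  have s: "(\<Sum>k\<in>insert a A. ?r k * word_egf P (insert a A - {k}) U) =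
      ?r a * word_egf P A U + ?f * (\<Sum>k\<in>A. ?r k * word_egf P (A - {k}) U)"
    using insert.hyps by (simp add: ins sum_distrib_left mult.left_commute)
  have c: "fps_const (1 - sum (pmf P) (insert a A) - sum (pmf P) U) =
      fps_const (1 - sum (pmf P) A - sum (pmf P) U) - ?p"
    using insert.hyps by simp
  have ring: "(1 - p * X * E) * (C * W + S) + (- (p * E) + p * p * X * E) * W =
      (C - p) * ((1 - p * X * E) * W) + (p * (1 - E) * W + (1 - p * X * E) * S)"
    for p X E C W S :: "real fps"
    by (simp add: algebra_simps)
  show ?case
    unfolding s c word_egf_insert[OF insert.hyps] fps_deriv_mult insert.IH df by (rule ring)
qed

lemma prob_avoiding_eq_coeff:
  fixes P :: "'b pmf"
  assumes "finite A" "finite U" "A \<inter> U = {}"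
  shows "measure_pmf.prob (replicate_pmf n P) (avoiding A U) = fact n * fps_nth (word_egf P A U) n"
  using assms
proof (induction n arbitrary: A U)
  case 0
  have "fps_nth (\<Prod>k\<in>B. f k) 0 = (\<Prod>k\<in>B. fps_nth (f k) 0)" for B :: "'b set" and f :: "'b \<Rightarrow> real fps"
    by (induction B rule: infinite_finite_induct) simp_all
  then have "fps_nth (word_egf P A U) 0 = 1"
    by (simp add: word_egf_def)
  then show ?case by (simp add: avoiding_def indicator_def)
next
  case (Suc n)
  have IH: "measure_pmf.prob (replicate_pmf n P) (avoiding (A - {k}) U) -
      measure_pmf.prob (replicate_pmf n P) (avoiding (A - {k}) (insert k U)) =
      fact n * fps_nth ((1 - fps_exp (- pmf P k)) * word_egf P (A - {k}) U) n" if "k \<in> A" for k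
  proof -
    have "k \<notin> U" using that Suc.prems by blast
    have "measure_pmf.prob (replicate_pmf n P) (avoiding (A - {k}) U) =
        fact n * fps_nth (word_egf P (A - {k}) U) n"
      using Suc.prems by (intro Suc.IH) auto
    moreover have "measure_pmf.prob (replicate_pmf n P) (avoiding (A - {k}) (insert k U)) =
        fact n * fps_nth (word_egf P (A - {k}) (insert k U)) n"
      using Suc.prems by (intro Suc.IH) auto
    ultimately show ?thesis
      using Suc.prems \<open>k \<notin> U\<close>
      by (simp add: word_egf_insert_untouched algebra_simps)
  qed
  have "fps_nth (fps_deriv (word_egf P A U)) n =
      (1 - sum (pmf P) A - sum (pmf P) U) * fps_nth (word_egf P A U) n +
      (\<Sum>k\<in>A. pmf P k * fps_nth ((1 - fps_exp (- pmf P k)) * word_egf P (A - {k}) U) n)"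
    unfolding fps_deriv_word_egf[OF Suc.prems(1,2)]
    by (simp add: fps_sum_nth mult.assoc del: fps_const_sub)
  moreover have "measure_pmf.prob (replicate_pmf (Suc n) P) (avoiding A U) =
      fact n * ((1 - sum (pmf P) A - sum (pmf P) U) * fps_nth (word_egf P A U) n +
      (\<Sum>k\<in>A. pmf P k * fps_nth ((1 - fps_exp (- pmf P k)) * word_egf P (A - {k}) U) n))"
    unfolding prob_avoiding_Suc[OF Suc.prems]
    by (simp add: IH Suc.IH[OF Suc.prems] algebra_simps sum_distrib_left)
  ultimately have "measure_pmf.prob (replicate_pmf (Suc n) P) (avoiding A U) =
      fact n * fps_nth (fps_deriv (word_egf P A U)) n"
    by simp
  then show ?case by (simp add: algebra_simps)
qed

lemma eval_word_egf:
  assumes "finite A"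
  shows "fps_conv_radius (word_egf P A {}) = \<infinity> \<and>
    eval_fps (word_egf P A {}) t = exp t * (\<Prod>k\<in>A. 1 - t * pmf P k * exp (- t * pmf P k))"
  using assms
proof (induction A)
  case empty
  then show ?case by (simp add: word_egf_def)
next
  case (insert a A)
  let ?g = "fps_const (pmf P a) * fps_X * fps_exp (- pmf P a)"
  have top: "x \<ge> \<infinity> \<Longrightarrow> x = \<infinity>" for x :: ereal by simp
  have r1: "fps_conv_radius (fps_const (pmf P a) * fps_X) = \<infinity>"
    using fps_conv_radius_mult[of "fps_const (pmf P a)" fps_X] by (simp add: top)
  have r2: "fps_conv_radius ?g = \<infinity>"
    using fps_conv_radius_mult[of "fps_const (pmf P a) * fps_X" "fps_exp (- pmf P a)"] r1
    by (simp add: top)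
  have r3: "fps_conv_radius (1 - ?g) = \<infinity>"
    using fps_conv_radius_diff[of 1 ?g] r2 by (simp add: top)
  have r4: "fps_conv_radius ((1 - ?g) * word_egf P A {}) = \<infinity>"
    using fps_conv_radius_mult[of "1 - ?g" "word_egf P A {}"] r3 insert.IH by (simp add: top)
  have "eval_fps ((1 - ?g) * word_egf P A {}) t =
      (1 - pmf P a * t * exp (- pmf P a * t)) * eval_fps (word_egf P A {}) t"
    using r1 r2 r3 insert.IH by (simp add: eval_fps_mult eval_fps_diff)
  then show ?case
    unfolding word_egf_insert[OF insert.hyps]
    using r4 insert.IH insert.hyps by (simp add: algebra_simps)
qed

section \<open>Poissonization\<close>

text \<open>
  The left-hand side is the probability of having no letter of \<open>A\<close> with multiplicity one in a word
  of Poisson distributed length with mean \<open>t\<close>. The multiplicities are then independent Poisson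
  variables with means \<open>t * p k\<close>, and each equals one with probability \<open>t * p k * exp (- t * p k)\<close>.
\<close>
lemma poissonization:
  fixes P :: "'b pmf"
  assumes "finite A"
  shows "(\<lambda>n. t ^ n / fact n * exp (- t) * measure_pmf.prob (replicate_pmf n P) (avoiding A {})) sums
    (\<Prod>k\<in>A. 1 - t * pmf P k * exp (- t * pmf P k))"
proof -
  have "(\<lambda>n. fps_nth (word_egf P A {}) n * t ^ n) sums eval_fps (word_egf P A {}) t"
    using eval_word_egf[OF assms, of P] by (intro sums_eval_fps) simp
  then have "(\<lambda>n. exp (- t) * (fps_nth (word_egf P A {}) n * t ^ n)) sums
      (exp (- t) * (exp t * (\<Prod>k\<in>A. 1 - t * pmf P k * exp (- t * pmf P k))))"
    using eval_word_egf[OF assms, of P] by (intro sums_mult) simp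
  moreover have "exp (- t) * (fps_nth (word_egf P A {}) n * t ^ n) =
      t ^ n / fact n * exp (- t) * measure_pmf.prob (replicate_pmf n P) (avoiding A {})" for n
    using assms by (simp add: prob_avoiding_eq_coeff)
  ultimately show ?thesis
    by (simp add: mult.assoc[symmetric] exp_minus)
qed

text \<open>
  A crude form of Stirling's formula: the ratio of consecutive values of \<open>n! e^n / n^n\<close> is
  \<open>e / (1 + 1/n)^n\<close>, which is at most \<open>(n + 1) / n\<close>.
\<close>
lemma fact_exp_bound:
  assumes "1 \<le> n"
  shows "fact n * exp (real n) \<le> exp 1 * real n * real n ^ n"
  using assms
proof (induction n rule: dec_induct)
  case base
  then show ?case by simp
next
  case (step n)
  then have n: "0 < real n" by simp
  have "1 - 1 / (1 + 1 / real n) \<le> ln (1 + 1 / real n)"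
    using n ln_le_minus_one[of "1 / (1 + 1 / real n)"] by (simp add: ln_div add_pos_pos add_nonneg_eq_0_iff split: if_splits)
  then have "1 \<le> real (Suc n) * ln (1 + 1 / real n)"
    using n by (simp add: field_simps)
  also have "\<dots> = ln ((1 + 1 / real n) ^ Suc n)"
    using n by (subst ln_realpow) (auto simp: add_pos_pos)
  finally have "exp 1 \<le> (1 + 1 / real n) ^ Suc n"
    using n by (subst (asm) ln_ge_iff) (auto simp: add_pos_pos)
  also have "1 + 1 / real n = real (Suc n) / real n"
    using n by (simp add: field_simps)
  finally have e: "exp 1 * real n ^ Suc n \<le> real (Suc n) ^ Suc n"
    using n by (simp add: power_divide field_simps)
  have "fact (Suc n) * exp (real (Suc n)) = real (Suc n) * exp 1 * (fact n * exp (real n))"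
    by (simp add: exp_add algebra_simps)
  also have "\<dots> \<le> real (Suc n) * exp 1 * (exp 1 * real n * real n ^ n)"
    by (intro mult_left_mono step.IH) auto
  also have "\<dots> = exp 1 * real (Suc n) * (exp 1 * real n ^ Suc n)"
    by (simp add: algebra_simps)
  also have "\<dots> \<le> exp 1 * real (Suc n) * real (Suc n) ^ Suc n"
    by (intro mult_left_mono e) auto
  finally show ?case .
qed

lemma xexp_minus_bounds:
  fixes x :: real
  assumes "0 \<le> x"
  shows "0 \<le> x * exp (- x)" "x * exp (- x) \<le> 1 / 2"
proof -
  show "0 \<le> x * exp (- x)" using assms by simp
  have "2 * x \<le> 1 + x + x\<^sup>2 / 2"
    using sum_squares_ge_zero[of "x - 1" 1] by (simp add: power2_eq_square algebra_simps)
  also have "\<dots> \<le> exp x" using assms by (rule exp_lower_Taylor_quadratic)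
  finally show "x * exp (- x) \<le> 1 / 2" by (simp add: exp_minus field_simps)
qed

text \<open>
  All summands of the Poissonized identity are nonnegative, so at \<open>t = n\<close> the \<open>n\<close>-th one alone is
  at most the product. The Poisson weight of its own mean is at least \<open>1 / (e * n)\<close>.
\<close>
lemma prob_avoiding_le:
  assumes "1 \<le> n" "finite A" "A \<subseteq> S"
  shows "measure_pmf.prob (replicate_pmf n P) (avoiding S {}) \<le>
    exp 1 * real n * exp (- (\<Sum>k\<in>A. real n * pmf P k * exp (- real n * pmf P k)))"
proof -
  let ?q = "\<lambda>m A. measure_pmf.prob (replicate_pmf m P) (avoiding A {})"
  let ?y = "\<lambda>k. real n * pmf P k * exp (- real n * pmf P k)"
  let ?w = "\<lambda>m. real n ^ m / fact m * exp (- real n)"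
  have "?w n * ?q n S \<le> ?w n * ?q n A"
    using assms(3) by (intro mult_left_mono measure_pmf.finite_measure_mono) (auto simp: avoiding_def)
  also have "\<dots> \<le> (\<Prod>k\<in>A. 1 - ?y k)"
    using sum_le_suminf[OF sums_summable[OF poissonization[OF assms(2), of "real n" P]], of "{n}"]
      sums_unique[OF poissonization[OF assms(2), of "real n" P]] by simp
  also have "\<dots> \<le> (\<Prod>k\<in>A. exp (- ?y k))"
  proof (intro prod_mono conjI)
    fix k
    show "0 \<le> 1 - ?y k" using xexp_minus_bounds(2)[of "real n * pmf P k"] by simp
    show "1 - ?y k \<le> exp (- ?y k)" using exp_ge_add_one_self[of "- ?y k"] by simp
  qed
  also have "\<dots> = exp (- (\<Sum>k\<in>A. ?y k))"
    using assms(2) by (simp add: exp_sum sum_negf[symmetric])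
  finally have le: "?w n * ?q n S \<le> exp (- (\<Sum>k\<in>A. ?y k))" .
  have "?q n S = (fact n * exp (real n) / real n ^ n) * (?w n * ?q n S)"
    using assms(1) by (simp add: exp_minus)
  also have "\<dots> \<le> (exp 1 * real n) * exp (- (\<Sum>k\<in>A. ?y k))"
    using fact_exp_bound[OF assms(1)] assms(1)
    by (intro mult_mono[OF _ le]) (auto simp: divide_le_eq)
  finally show ?thesis .
qed

lemma sums_expectation_pmf_nat:
  fixes f :: "nat \<Rightarrow> real"
  assumes "\<And>n. \<bar>f n\<bar> \<le> B"
  shows "(\<lambda>n. pmf p n * f n) sums measure_pmf.expectation p f"
proof -
  have "integrable (measure_pmf p) f"
    using assms by (intro measure_pmf.integrable_const_bound[where B=B]) auto
  then have "integrable (count_space UNIV) (\<lambda>n. pmf p n * f n)"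
    by (simp add: measure_pmf_eq_density integrable_density)
  then have "(\<lambda>n. pmf p n * f n) sums (\<integral>n. pmf p n * f n \<partial>count_space UNIV)"
    by (rule sums_integral_count_space_nat)
  then show ?thesis
    by (simp add: measure_pmf_eq_density integral_density)
qed

text \<open>
  If the probabilities were eventually below \<open>c / 2\<close>, so would be their Poisson averages up to the
  mass of \<open>{..<N}\<close>, which vanishes as \<open>t\<close> grows. The averages are at least \<open>c\<close> for every finite
  part of \<open>S\<close>, and hence for \<open>S\<close> itself by continuity of measure.
\<close>
lemma prob_avoiding_frequently_ge:
  fixes P :: "nat pmf"
  assumes c: "0 < c"
    and lb: "\<And>A t. finite A \<Longrightarrow> A \<subseteq> S \<Longrightarrow> 0 \<le> t \<Longrightarrow> c \<le> (\<Prod>k\<in>A. 1 - t * pmf P k * exp (- t * pmf P k))"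
  shows "\<exists>\<^sub>F n in sequentially. c / 2 \<le> measure_pmf.prob (replicate_pmf n P) (avoiding S {})"
proof (rule ccontr)
  let ?q = "\<lambda>n. measure_pmf.prob (replicate_pmf n P) (avoiding S {})"
  assume "\<not> ?thesis"
  then obtain N where N: "\<And>n. n \<ge> N \<Longrightarrow> ?q n < c / 2"
    unfolding not_frequently eventually_sequentially not_le by blast
  have lower: "c \<le> (\<Sum>n<N. t ^ n / exp t) + c / 2" if t: "0 < t" for t
  proof -
    define L where "L = bind_pmf (poisson_pmf t) (\<lambda>n. replicate_pmf n P)"
    define D where "D K = avoiding (S \<inter> {..K}) {}" for K
    have "measure_pmf.prob L (D K) \<ge> c" for K
    proof -
      have fin: "finite (S \<inter> {..K})" by simp
      have "(\<lambda>n. pmf (poisson_pmf t) n * measure_pmf.prob (replicate_pmf n P) (D K)) sums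
          measure_pmf.prob L (D K)"
        unfolding L_def measure_bind_pmf_expectation
        by (rule sums_expectation_pmf_nat[where B=1]) simp
      with poissonization[OF fin, of t P]
      have "measure_pmf.prob L (D K) = (\<Prod>k\<in>S \<inter> {..K}. 1 - t * pmf P k * exp (- t * pmf P k))"
        unfolding D_def using t by (auto intro: sums_unique2)
      then show ?thesis using lb[OF fin, of t] t by simp
    qed
    moreover have "(\<lambda>K. measure_pmf.prob L (D K)) \<longlonglongrightarrow> measure_pmf.prob L (\<Inter>K. D K)"
      by (rule measure_pmf.finite_Lim_measure_decseq)
        (auto simp: D_def avoiding_def decseq_def)
    ultimately have "c \<le> measure_pmf.prob L (\<Inter>K. D K)"
      by (intro LIMSEQ_le_const) auto
    also have "(\<Inter>K. D K) = avoiding S {}"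
      by (auto simp: D_def avoiding_def)
    also have "measure_pmf.prob L (avoiding S {}) = measure_pmf.expectation (poisson_pmf t) ?q"
      unfolding L_def measure_bind_pmf_expectation ..
    also have "\<dots> \<le> measure_pmf.expectation (poisson_pmf t) (\<lambda>n. indicator {..<N} n + c / 2)"
    proof (rule integral_mono)
      show "integrable (poisson_pmf t) ?q"
        by (intro measure_pmf.integrable_const_bound[where B=1]) auto
      show "integrable (poisson_pmf t) (\<lambda>n. indicator {..<N} n + c / 2)"
        using c by (intro measure_pmf.integrable_const_bound[where B="1 + c / 2"])
          (auto simp: indicator_def)
      show "?q n \<le> indicator {..<N} n + c / 2" for n
        using N[of n] c measure_pmf.prob_le_1[of "replicate_pmf n P" "avoiding S {}"]
        by (cases "n < N") (simp_all add: indicator_def add_increasing2 del: measure_pmf.prob_le_1)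
    qed
    also have "\<dots> = measure_pmf.prob (poisson_pmf t) {..<N} + c / 2"
      by (subst Bochner_Integration.integral_add)
        (auto intro!: measure_pmf.integrable_const_bound[where B=1])
    also have "measure_pmf.prob (poisson_pmf t) {..<N} = (\<Sum>n<N. t ^ n / fact n * exp (- t))"
      using t by (simp add: measure_measure_pmf_finite)
    also have "\<dots> \<le> (\<Sum>n<N. t ^ n / exp t)"
      using t by (intro sum_mono) (simp add: exp_minus field_simps mult_le_cancel_left1 fact_ge_1)
    finally show ?thesis by simp
  qed
  have "((\<lambda>t::real. (\<Sum>n<N. t ^ n / exp t) + c / 2) \<longlongrightarrow> (\<Sum>n<N. 0) + c / 2) at_top"
    by (intro tendsto_intros tendsto_power_div_exp_0)
  then have "c \<le> (\<Sum>n<N. 0) + c / 2"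
    by (rule tendsto_lowerbound) (auto intro: eventually_mono[OF eventually_gt_at_top[of 0]] lower)
  with c show False by simp
qed

section \<open>Summable return probabilities leave a chance of never returning\<close>

text \<open>
  Meant for words of length at least \<open>n\<close>. A lower time \<open>m\<close> other than \<open>1\<close> occurs because a
  summable series only controls the returns after some time.
\<close>
definition nonreturning :: "'b set \<Rightarrow> nat \<Rightarrow> nat \<Rightarrow> 'b list set" where
  "nonreturning S m n = {xs. \<forall>j\<in>{m..n}. take j xs \<notin> avoiding S {}}"

lemma map_take_replicate_pmf:
  "map_pmf (take n) (replicate_pmf (n + m) P) = replicate_pmf n P"
proof -
  have "map_pmf (take n) (replicate_pmf (n + m) P) =
      bind_pmf (replicate_pmf n P) (\<lambda>xs. map_pmf (\<lambda>ys. take n (xs @ ys)) (replicate_pmf m P))"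
    by (simp add: replicate_pmf_distrib map_bind_pmf map_pmf_def[symmetric] map_pmf_comp)
  also have "\<dots> = bind_pmf (replicate_pmf n P) return_pmf"
    by (intro bind_pmf_cong) (auto simp: set_replicate_pmf)
  finally show ?thesis by (simp add: bind_return_pmf')
qed

lemma prob_take_replicate_pmf:
  assumes "n \<le> N"
  shows "measure_pmf.prob (replicate_pmf N P) {xs. take n xs \<in> X} = measure_pmf.prob (replicate_pmf n P) X"
proof -
  have "measure_pmf.prob (replicate_pmf n P) X = measure_pmf.prob (map_pmf (take n) (replicate_pmf N P)) X"
    using map_take_replicate_pmf[of n "N - n" P] assms by simp
  then show ?thesis by (simp add: vimage_def)
qed

lemma nonreturning_prob_antimono:
  assumes "N \<le> N'"
  shows "measure_pmf.prob (replicate_pmf N' P) (nonreturning S 1 N') \<le>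
    measure_pmf.prob (replicate_pmf N P) (nonreturning S 1 N)"
proof -
  have "measure_pmf.prob (replicate_pmf N' P) (nonreturning S 1 N') \<le>
      measure_pmf.prob (replicate_pmf N' P) {xs. take N xs \<in> nonreturning S 1 N}"
    using assms by (intro measure_pmf.finite_measure_mono) (auto simp: nonreturning_def min_def)
  also have "\<dots> = measure_pmf.prob (replicate_pmf N P) (nonreturning S 1 N)"
    using assms by (rule prob_take_replicate_pmf)
  finally show ?thesis .
qed

lemma pmf_replicate_pmf:
  "pmf (replicate_pmf n P) xs = (if length xs = n then \<Prod>x\<leftarrow>xs. pmf P x else 0)"
proof (induction n arbitrary: xs)
  case 0
  then show ?case by (simp add: indicator_def)
next
  case (Suc n)
  have *: "pmf (replicate_pmf (Suc n) P) xs =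
      measure_pmf.expectation P (\<lambda>x. measure_pmf.prob (replicate_pmf n P) {ys. x # ys = xs})"
    using prob_replicate_Suc[of n P "{xs}"] by (simp add: measure_pmf_single)
  show ?case
  proof (cases xs)
    case Nil
    then show ?thesis unfolding * by simp
  next
    case (Cons y ys)
    have "measure_pmf.prob (replicate_pmf n P) {zs. x # zs = xs} =
        indicator {y} x * pmf (replicate_pmf n P) ys" for x
      by (cases "x = y") (auto simp: Cons measure_pmf_single)
    then show ?thesis unfolding * by (simp add: Suc.IH Cons measure_pmf_single)
  qed
qed

text \<open>The bound check makes this an involution on all lists.\<close>
definition swap_first :: "nat \<Rightarrow> 'b list \<Rightarrow> 'b list" where
  "swap_first i xs = (if i < length xs then xs[0 := xs ! i, i := xs ! 0] else xs)"

lemma length_swap_first [simp]: "length (swap_first i xs) = length xs"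
  by (simp add: swap_first_def)

lemma swap_first_involution: "swap_first i (swap_first i xs) = xs"
proof (cases "i < length xs")
  case True
  then have "0 < length xs" by linarith
  with True show ?thesis
    by (auto simp: swap_first_def nth_list_update intro!: nth_equalityI simp del: length_greater_0_conv)
qed (simp add: swap_first_def)

lemma mset_swap_first: "mset (swap_first i xs) = mset xs"
proof (cases "i < length xs")
  case True
  then have "0 < length xs" by linarith
  with True show ?thesis using mset_swap[of i xs 0] by (simp add: swap_first_def)
qed (simp add: swap_first_def)

lemma take_swap_first:
  assumes "i < n"
  shows "take n (swap_first i xs) = swap_first i (take n xs)"
  using assms by (auto simp: swap_first_def take_update_swap)

lemma map_swap_first_replicate_pmf:
  "map_pmf (swap_first i) (replicate_pmf n P) = replicate_pmf n P"
proof (rule pmf_eqI)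
  fix xs :: "'a list"
  have inj: "inj (swap_first i :: 'a list \<Rightarrow> _)"
    by (metis injI swap_first_involution)
  have "pmf (map_pmf (swap_first i) (replicate_pmf n P)) (swap_first i (swap_first i xs)) =
      pmf (replicate_pmf n P) (swap_first i xs)"
    by (rule pmf_map_inj'[OF inj])
  also have "prod_list (map (pmf P) (swap_first i xs)) = prod_list (map (pmf P) xs)"
    by (metis mset_swap_first mset_map prod_mset_prod_list)
  then have "pmf (replicate_pmf n P) (swap_first i xs) = pmf (replicate_pmf n P) xs"
    by (simp add: pmf_replicate_pmf)
  finally show "pmf (map_pmf (swap_first i) (replicate_pmf n P)) xs = pmf (replicate_pmf n P) xs"
    by (simp add: swap_first_involution)
qed

text \<open>
  A letter drawn first and occurring only once up to time \<open>n\<close> has multiplicity one at every time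
  from \<open>1\<close> to \<open>n\<close>.
\<close>
lemma nonreturning_if_first_letter_singleton:
  assumes "0 < n" "n \<le> length xs" "xs ! 0 \<in> S" "count (mset (take n xs)) (xs ! 0) = 1"
    "xs \<in> nonreturning S n N"
  shows "xs \<in> nonreturning S 1 N"
  unfolding nonreturning_def mem_Collect_eq
proof
  fix j assume j: "j \<in> {1..N}"
  show "take j xs \<notin> avoiding S {}"
  proof (cases "n \<le> j")
    case True
    with j assms(5) show ?thesis by (auto simp: nonreturning_def)
  next
    case False
    obtain x ys where xs: "xs = x # ys" using assms(1,2) by (cases xs) auto
    obtain j' where j': "j = Suc j'" using j by (cases j) auto
    obtain n' where n': "n = Suc n'" using assms(1) by (cases n) auto
    have "mset (take j' ys) \<subseteq># mset (take n' ys)"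
      using False j' n' by (metis Suc_le_mono linorder_linear mset_subset_eq_add_left append_take_drop_id
          mset_append take_take min.absorb1)
    then have "count (mset (take j' ys)) x \<le> count (mset (take n' ys)) x"
      by (rule mset_subset_eq_count)
    moreover have "count (mset (take n' ys)) x = 0" using assms(4) by (simp add: xs n')
    ultimately have "count (mset (take j' ys)) x = 0" by (metis le_zero_eq)
    then have "count (mset (take j xs)) x = 1" by (simp add: xs j')
    with assms(3) show ?thesis by (auto simp: avoiding_def xs)
  qed
qed

text \<open>
  Choose \<open>n\<close> so large that the probabilities of returns from time \<open>n\<close> on sum to at most \<open>1/2\<close>.
  When there is no such return, one of the first \<open>n\<close> positions carries a letter that
  is single at time \<open>n\<close>. Moving it to the front costs a factor \<open>n\<close> in a union bound over the
  positions, which gives \<open>1 / (2 n)\<close> for all \<open>N\<close> at once.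
\<close>
lemma nonreturning_prob_ge:
  fixes P :: "'b pmf"
  assumes "summable (\<lambda>n. measure_pmf.prob (replicate_pmf n P) (avoiding S {}))"
  obtains \<delta> where "0 < \<delta>" "\<And>N. \<delta> \<le> measure_pmf.prob (replicate_pmf N P) (nonreturning S 1 N)"
proof -
  let ?q = "\<lambda>n. measure_pmf.prob (replicate_pmf n P) (avoiding S {})"
  let ?r = "\<lambda>N. measure_pmf.prob (replicate_pmf N P) (nonreturning S 1 N)"
  obtain n0 where n0: "\<And>n. n \<ge> n0 \<Longrightarrow> norm (\<Sum>i. ?q (i + n)) < 1 / 2"
    using suminf_exist_split[OF _ assms, of "1/2"] by auto
  \<comment> \<open>positive, since the word \<open>[]\<close> at time \<open>0\<close> has no letter to be moved to the front\<close>
  define n where "n = Suc n0"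
  have tail: "(\<Sum>j=n..N. ?q j) \<le> 1 / 2" for N
  proof -
    have sm: "summable (\<lambda>i. ?q (i + n))" using assms by (rule summable_ignore_initial_segment)
    have "(\<Sum>j=n..N. ?q j) = (\<Sum>i<Suc N - n. ?q (i + n))"
      by (rule sum.reindex_bij_witness[of _ "\<lambda>i. i + n" "\<lambda>j. j - n"]) auto
    also have "\<dots> \<le> (\<Sum>i. ?q (i + n))"
      by (intro sum_le_suminf sm) auto
    also have "\<dots> \<le> 1 / 2" using n0[of n] by (simp add: n_def)
    finally show ?thesis .
  qed
  have large: "1 / (2 * real n) \<le> ?r N" if N: "n \<le> N" for N
  proof -
    let ?L = "replicate_pmf N P"
    define B where "B i = {xs. length xs = N \<and> xs \<in> nonreturning S n N \<and> xs ! i \<in> S \<and>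
      count (mset (take n xs)) (xs ! i) = 1}" for i
    have "1 - measure_pmf.prob ?L (nonreturning S n N) = measure_pmf.prob ?L (- nonreturning S n N)"
      using measure_pmf.prob_compl[of "nonreturning S n N" ?L] by (simp add: Compl_eq_Diff_UNIV)
    also have "- nonreturning S n N = (\<Union>j\<in>{n..N}. {xs. take j xs \<in> avoiding S {}})"
      by (auto simp: nonreturning_def)
    also have "measure_pmf.prob ?L \<dots> \<le> (\<Sum>j=n..N. measure_pmf.prob ?L {xs. take j xs \<in> avoiding S {}})"
      by (rule measure_pmf.finite_measure_subadditive_finite) auto
    also have "\<dots> = (\<Sum>j=n..N. ?q j)"
      by (intro sum.cong refl prob_take_replicate_pmf) auto
    also note tail
    finally have "1 / 2 \<le> measure_pmf.prob ?L (nonreturning S n N)" by simp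
    also have "\<dots> \<le> measure_pmf.prob ?L (\<Union>i<n. B i)"
    proof (rule measure_pmf.finite_measure_mono_AE)
      show "AE xs in ?L. xs \<in> nonreturning S n N \<longrightarrow> xs \<in> (\<Union>i<n. B i)"
      proof (intro AE_pmfI impI)
        fix xs assume "xs \<in> set_pmf ?L" and xs: "xs \<in> nonreturning S n N"
        then have len: "length xs = N" by (simp add: set_replicate_pmf)
        have "take n xs \<notin> avoiding S {}" using xs N by (auto simp: nonreturning_def)
        then obtain k where k: "k \<in> S" "count (mset (take n xs)) k = 1"
          by (auto simp: avoiding_def)
        then have "k \<in> set (take n xs)"
          by (metis count_inI set_mset_mset zero_neq_one)
        then obtain i where "i < n" "xs ! i = k"
          using N len by (auto simp: in_set_conv_nth)
        with k xs len show "xs \<in> (\<Union>i<n. B i)" by (auto simp: B_def)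
      qed
    qed auto
    also have "\<dots> \<le> (\<Sum>i<n. measure_pmf.prob ?L (B i))"
      by (rule measure_pmf.finite_measure_subadditive_finite) auto
    also have "\<dots> \<le> (\<Sum>i<n. ?r N)"
    proof (rule sum_mono)
      fix i assume i: "i \<in> {..<n}"
      have "measure_pmf.prob ?L (B i) \<le> measure_pmf.prob ?L {xs. swap_first i xs \<in> nonreturning S 1 N}"
      proof (rule measure_pmf.finite_measure_mono; safe?)
        fix xs assume xs: "xs \<in> B i"
        have msets: "mset (take j (swap_first i xs)) = mset (take j xs)" if "n \<le> j" for j
          using that i by (simp add: take_swap_first mset_swap_first)
        have "swap_first i xs ! 0 = xs ! i"
          using xs i N by (auto simp: swap_first_def B_def nth_list_update)
        then show "swap_first i xs \<in> nonreturning S 1 N"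
          using xs i N msets
          by (intro nonreturning_if_first_letter_singleton[of n])
            (auto simp: B_def nonreturning_def avoiding_def)
      qed auto
      also have "\<dots> = measure_pmf.prob (map_pmf (swap_first i) ?L) (nonreturning S 1 N)"
        by (simp add: vimage_def)
      finally show "measure_pmf.prob ?L (B i) \<le> ?r N"
        by (simp only: map_swap_first_replicate_pmf)
    qed
    finally show ?thesis by (simp add: n_def field_simps)
  qed
  have "1 / (2 * real n) \<le> ?r N" for N
    using large[of "max n N"] nonreturning_prob_antimono[of N "max n N" P S] by simp
  then show ?thesis
    using that[of "1 / (2 * real n)"] by (simp add: n_def)
qed

section \<open>Return probabilities bounded below force a return\<close>

text \<open>
  Having occurred at most once is to be untouched or to have multiplicity one; the coefficients
  of \<open>word_egf\<close> give both probabilities.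
\<close>
lemma prob_count_lt_2_tendsto_0:
  fixes P :: "'b pmf"
  assumes "k \<in> set_pmf P"
  shows "(\<lambda>m. measure_pmf.prob (replicate_pmf m P) {ys. count (mset ys) k < 2}) \<longlonglongrightarrow> 0"
proof -
  let ?p = "pmf P k" and ?L = "\<lambda>m. replicate_pmf m P"
  have p: "0 < ?p" "?p \<le> 1" using assms by (simp_all add: pmf_positive pmf_le_1)
  have none: "measure_pmf.prob (?L m) (avoiding {} {k}) = (1 - ?p) ^ m" for m
    by (simp add: prob_avoiding_eq_coeff word_egf_def flip: fps_exp_add_mult)
  have one: "1 - measure_pmf.prob (?L (Suc m)) (avoiding {k} {}) = ?p * (real m * (1 - ?p) ^ m + (1 - ?p) ^ m)" for m
  proof -
    have "word_egf P {k} {} = fps_exp 1 - fps_const ?p * (fps_X * fps_exp (1 - ?p))"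
      using fps_exp_add_mult[of 1 "- ?p"] by (simp add: word_egf_def algebra_simps)
    then have "measure_pmf.prob (?L (Suc m)) (avoiding {k} {}) =
        fact (Suc m) * (1 / fact (Suc m) - ?p * ((1 - ?p) ^ m / fact m))"
      by (simp add: prob_avoiding_eq_coeff distrib_right del: replicate_pmf.simps)
    also have "\<dots> = 1 - real (Suc m) * ?p * (1 - ?p) ^ m"
      by (simp add: right_diff_distrib fact_Suc del: of_nat_Suc)
    finally show ?thesis by (simp add: algebra_simps del: replicate_pmf.simps)
  qed
  have bound: "measure_pmf.prob (?L (Suc m)) {ys. count (mset ys) k < 2} \<le>
      (1 - ?p) ^ Suc m + ?p * (real m * (1 - ?p) ^ m + (1 - ?p) ^ m)" for m
  proof -
    have "{ys. count (mset ys) k < 2} = avoiding {} {k} \<union> - avoiding {k} {}"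
      by (auto simp: avoiding_def less_2_cases_iff)
    then have "measure_pmf.prob (?L (Suc m)) {ys. count (mset ys) k < 2} \<le>
        measure_pmf.prob (?L (Suc m)) (avoiding {} {k}) + measure_pmf.prob (?L (Suc m)) (- avoiding {k} {})"
      by (simp add: measure_Un_le)
    also have "measure_pmf.prob (?L (Suc m)) (- avoiding {k} {}) =
        1 - measure_pmf.prob (?L (Suc m)) (avoiding {k} {})"
      using measure_pmf.prob_compl[of "avoiding {k} {}" "?L (Suc m)"] by (simp add: Compl_eq_Diff_UNIV)
    finally show ?thesis unfolding none one .
  qed
  have lim: "(\<lambda>m. (1 - ?p) ^ Suc m + ?p * (real m * (1 - ?p) ^ m + (1 - ?p) ^ m)) \<longlonglongrightarrow> 0 + ?p * (0 + 0)"
    using p by (intro tendsto_intros powser_times_n_limit_0 LIMSEQ_power_zero LIMSEQ_Suc) auto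
  have "(\<lambda>m. measure_pmf.prob (?L (Suc m)) {ys. count (mset ys) k < 2}) \<longlonglongrightarrow> 0"
    by (rule tendsto_sandwich[OF _ _ tendsto_const lim[simplified]]) (use bound in auto)
  then show ?thesis by (rule LIMSEQ_imp_Suc)
qed

definition not_repeated :: "'b list \<Rightarrow> 'b list set" where
  "not_repeated xs = {ys. \<exists>k\<in>set xs. count (mset ys) k < 2}"

lemma prob_not_repeated_tendsto_0:
  assumes "set xs \<subseteq> set_pmf P"
  shows "(\<lambda>m. measure_pmf.prob (replicate_pmf m P) (not_repeated xs)) \<longlonglongrightarrow> 0"
proof -
  have le: "measure_pmf.prob (replicate_pmf m P) (not_repeated xs) \<le>
      (\<Sum>k\<in>set xs. measure_pmf.prob (replicate_pmf m P) {ys. count (mset ys) k < 2})" for m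
  proof -
    have "not_repeated xs = (\<Union>k\<in>set xs. {ys. count (mset ys) k < 2})"
      by (auto simp: not_repeated_def)
    then show ?thesis by (simp add: measure_pmf.finite_measure_subadditive_finite)
  qed
  have lim: "(\<lambda>m. \<Sum>k\<in>set xs. measure_pmf.prob (replicate_pmf m P) {ys. count (mset ys) k < 2})
      \<longlonglongrightarrow> (\<Sum>k\<in>set xs. 0)"
    using assms by (intro tendsto_sum prob_count_lt_2_tendsto_0) auto
  show ?thesis
    by (rule tendsto_sandwich[OF _ _ tendsto_const lim[simplified]]) (use le in auto)
qed

text \<open>
  Conditioning on the first \<open>n\<close> letters \<open>xs\<close>. Once every letter of \<open>xs\<close> has been drawn twice more,
  it cannot have multiplicity one, so the whole word is in a ground state as soon as the \<open>m\<close> new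
  letters on their own are. The last summand bounds the probability that this forgetting of the
  past has not yet happened.
\<close>
lemma prob_nonreturning_add_le:
  fixes P :: "'b pmf"
  assumes "1 \<le> m"
  shows "measure_pmf.prob (replicate_pmf (n + m) P) (nonreturning S 1 (n + m)) \<le>
    (1 - measure_pmf.prob (replicate_pmf m P) (avoiding S {})) *
      measure_pmf.prob (replicate_pmf n P) (nonreturning S 1 n) +
    measure_pmf.expectation (replicate_pmf n P)
      (\<lambda>xs. measure_pmf.prob (replicate_pmf m P) (not_repeated xs))"
proof -
  let ?L = "\<lambda>m. replicate_pmf m P"
  let ?q = "measure_pmf.prob (?L m) (avoiding S {})"
  let ?h = "\<lambda>xs. measure_pmf.prob (?L m) (not_repeated xs)"
  let ?X = "nonreturning S 1 n" and ?Y = "nonreturning S 1 (n + m)"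
  have "measure_pmf.prob (?L (n + m)) ?Y =
      measure_pmf.expectation (?L n) (\<lambda>xs. measure_pmf.prob (?L m) {ys. xs @ ys \<in> ?Y})"
    by (simp add: replicate_pmf_distrib measure_bind_pmf_expectation map_pmf_def[symmetric] vimage_def)
  also have "\<dots> \<le> measure_pmf.expectation (?L n) (\<lambda>xs. (1 - ?q) * indicator ?X xs + ?h xs)"
  proof (rule integral_mono_AE)
    show "integrable (?L n) (\<lambda>xs. measure_pmf.prob (?L m) {ys. xs @ ys \<in> ?Y})"
      by (intro measure_pmf.integrable_const_bound[where B=1]) auto
    show "integrable (?L n) (\<lambda>xs. (1 - ?q) * indicator ?X xs + ?h xs)"
      by (intro Bochner_Integration.integrable_add integrable_mult_right
          measure_pmf.integrable_const_bound[where B=1]) auto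
    show "AE xs in ?L n. measure_pmf.prob (?L m) {ys. xs @ ys \<in> ?Y} \<le> (1 - ?q) * indicator ?X xs + ?h xs"
    proof (intro AE_pmfI)
      fix xs assume "xs \<in> set_pmf (?L n)"
      then have len: "length xs = n" by (simp add: set_replicate_pmf)
      show "measure_pmf.prob (?L m) {ys. xs @ ys \<in> ?Y} \<le> (1 - ?q) * indicator ?X xs + ?h xs"
      proof (cases "xs \<in> ?X")
        case False
        then obtain j where "1 \<le> j" "j \<le> n" "take j xs \<in> avoiding S {}"
          by (auto simp: nonreturning_def)
        then have "{ys. xs @ ys \<in> ?Y} = {}"
          using len by (force simp: nonreturning_def)
        then show ?thesis using False by simp
      next
        case True
        have "measure_pmf.prob (?L m) {ys. xs @ ys \<in> ?Y} \<le> measure_pmf.prob (?L m) (- avoiding S {} \<union> not_repeated xs)"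
        proof (rule measure_pmf.finite_measure_mono_AE)
          show "AE ys in ?L m. ys \<in> {ys. xs @ ys \<in> ?Y} \<longrightarrow> ys \<in> - avoiding S {} \<union> not_repeated xs"
          proof (intro AE_pmfI impI)
            fix ys assume "ys \<in> set_pmf (?L m)" and "ys \<in> {ys. xs @ ys \<in> ?Y}"
            then have "length ys = m" "xs @ ys \<in> ?Y" by (auto simp: set_replicate_pmf)
            then have "xs @ ys \<notin> avoiding S {}"
              using len assms by (auto simp: nonreturning_def dest: bspec[of _ _ "n + m"])
            then obtain k where k: "k \<in> S" "count (mset xs) k + count (mset ys) k = 1"
              by (auto simp: avoiding_def)
            show "ys \<in> - avoiding S {} \<union> not_repeated xs"
            proof (cases "k \<in> set xs")
              case True
              moreover have "count (mset ys) k < 2" using k(2) by linarith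
              ultimately show ?thesis by (auto simp: not_repeated_def)
            next
              case False
              then have "count (mset xs) k = 0" by simp
              with k show ?thesis by (auto simp: avoiding_def)
            qed
          qed
        qed auto
        also have "\<dots> \<le> measure_pmf.prob (?L m) (- avoiding S {}) + ?h xs"
          by (rule measure_Un_le) auto
        also have "measure_pmf.prob (?L m) (- avoiding S {}) = 1 - ?q"
          using measure_pmf.prob_compl[of "avoiding S {}" "?L m"] by (simp add: Compl_eq_Diff_UNIV)
        finally show ?thesis using True by simp
      qed
    qed
  qed
  also have "\<dots> = (1 - ?q) * measure_pmf.prob (?L n) ?X + measure_pmf.expectation (?L n) ?h"
    by (subst Bochner_Integration.integral_add)
      (auto intro!: integrable_mult_right measure_pmf.integrable_const_bound[where B=1])
  finally show ?thesis .
qed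

text \<open>
  Along the infinitely many \<open>m\<close> with return probability at least \<open>c\<close>, the previous bound tends to
  \<open>l \<le> (1 - c) * r n\<close>, where \<open>l\<close> is the limit of the nonincreasing probabilities \<open>r n\<close>; letting
  \<open>n\<close> grow gives \<open>l \<le> (1 - c) * l\<close>.
\<close>
lemma nonreturning_prob_tendsto_0:
  fixes P :: "'b pmf"
  assumes c: "0 < c"
    and freq: "\<exists>\<^sub>F m in sequentially. c \<le> measure_pmf.prob (replicate_pmf m P) (avoiding S {})"
  shows "(\<lambda>n. measure_pmf.prob (replicate_pmf n P) (nonreturning S 1 n)) \<longlonglongrightarrow> 0"
proof -
  let ?r = "\<lambda>n. measure_pmf.prob (replicate_pmf n P) (nonreturning S 1 n)"
  let ?H = "\<lambda>n m. measure_pmf.expectation (replicate_pmf n P)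
      (\<lambda>xs. measure_pmf.prob (replicate_pmf m P) (not_repeated xs))"
  obtain l where l: "?r \<longlonglongrightarrow> l" "\<And>n. l \<le> ?r n"
    using decseq_convergent[of ?r 0] nonreturning_prob_antimono[of _ _ P S]
    by (auto simp: decseq_def)
  have H: "?H n \<longlonglongrightarrow> 0" for n
  proof -
    have "?H n \<longlonglongrightarrow> measure_pmf.expectation (replicate_pmf n P) (\<lambda>xs. 0)"
    proof (rule integral_dominated_convergence[where w="\<lambda>_. 1"])
      show "AE xs in replicate_pmf n P. (\<lambda>m. measure_pmf.prob (replicate_pmf m P) (not_repeated xs)) \<longlonglongrightarrow> 0"
        by (intro AE_pmfI prob_not_repeated_tendsto_0) (auto simp: set_replicate_pmf lists_def)
    qed auto
    then show ?thesis by simp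
  qed
  have step: "l \<le> (1 - c) * ?r n" for n
  proof (rule field_le_epsilon)
    fix e :: real assume "0 < e"
    then have "\<forall>\<^sub>F m in sequentially. ?H n m < e" by (intro order_tendstoD[OF H])
    then have "\<forall>\<^sub>F m in sequentially. ?H n m < e \<and> 1 \<le> m"
      using eventually_ge_at_top by (rule eventually_conj)
    then obtain m where m: "c \<le> measure_pmf.prob (replicate_pmf m P) (avoiding S {})" "?H n m < e" "1 \<le> m"
      using frequently_ex[OF frequently_eventually_conj[OF freq]] by blast
    have "l \<le> ?r (n + m)" by (rule l)
    also note prob_nonreturning_add_le[OF m(3), of n P S]
    also have "(1 - measure_pmf.prob (replicate_pmf m P) (avoiding S {})) * ?r n + ?H n m \<le> (1 - c) * ?r n + e"
      using m by (intro add_mono mult_right_mono) auto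
    finally show "l \<le> (1 - c) * ?r n + e" .
  qed
  have "(\<lambda>n. (1 - c) * ?r n) \<longlonglongrightarrow> (1 - c) * l"
    by (intro tendsto_intros l)
  then have "l \<le> (1 - c) * l"
    by (rule LIMSEQ_le_const) (use step in auto)
  then have "l * c \<le> 0" by (simp add: algebra_simps)
  then have "l \<le> 0" using c by (simp add: mult_le_0_iff)
  moreover have "0 \<le> l" by (rule LIMSEQ_le_const[OF l(1)]) auto
  ultimately show ?thesis using l(1) by simp
qed

section \<open>The first letters drawn by the model\<close>

definition first_letters :: "(nat \<Rightarrow> 'a \<Rightarrow> 'b) \<Rightarrow> nat \<Rightarrow> 'a \<Rightarrow> 'b list" where
  "first_letters \<xi> n \<omega> = map (\<lambda>i. \<xi> i \<omega>) [1..<Suc n]"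

lemma first_letters_eq_iff:
  "first_letters \<xi> n \<omega> = xs \<longleftrightarrow> length xs = n \<and> (\<forall>i\<in>{1..n}. \<xi> i \<omega> = xs ! (i - 1))"
proof -
  have "first_letters \<xi> n \<omega> = xs \<longleftrightarrow> length xs = n \<and> (\<forall>j<n. \<xi> (Suc j) \<omega> = xs ! j)"
    by (auto simp: first_letters_def list_eq_iff_nth_eq simp del: upt_Suc)
  moreover have "(\<forall>i\<in>Suc ` {..<n}. \<xi> i \<omega> = xs ! (i - 1)) \<longleftrightarrow> (\<forall>j<n. \<xi> (Suc j) \<omega> = xs ! j)"
    by auto
  ultimately show ?thesis by (simp add: image_Suc_lessThan)
qed

lemma take_first_letters: "j \<le> n \<Longrightarrow> take j (first_letters \<xi> n \<omega>) = first_letters \<xi> j \<omega>"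
  by (simp add: first_letters_def take_map take_upt del: upt_Suc)

lemma (in damaged_bits) measurable_first_letters:
  "first_letters \<xi> n \<in> measurable M (count_space UNIV)"
proof -
  have letter: "{\<omega> \<in> space M. \<xi> i \<omega> = x} \<in> events" if "i \<in> {1..n}" for i x
  proof -
    have "\<xi> i -` {x} \<inter> space M \<in> events"
      using measurable_sets[OF measurable_xi[of i], of "{x}"] that by simp
    moreover have "\<xi> i -` {x} \<inter> space M = {\<omega> \<in> space M. \<xi> i \<omega> = x}" by auto
    ultimately show ?thesis by simp
  qed
  have "first_letters \<xi> n -` {xs} \<inter> space M \<in> events" for xs
  proof -
    have "{\<omega> \<in> space M. length xs = n \<and> (\<forall>i\<in>{1..n}. \<xi> i \<omega> = xs ! (i - 1))} \<in> events"
    proof (cases "length xs = n")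
      case True
      have "{\<omega> \<in> space M. \<forall>i\<in>{1..n}. \<xi> i \<omega> = xs ! (i - 1)} \<in> events"
        by (rule sets.sets_Collect_finite_All) (rule letter, assumption, simp)
      with True show ?thesis by simp
    qed simp
    moreover have "first_letters \<xi> n -` {xs} \<inter> space M =
        {\<omega> \<in> space M. length xs = n \<and> (\<forall>i\<in>{1..n}. \<xi> i \<omega> = xs ! (i - 1))}"
      by (auto simp: first_letters_eq_iff vimage_def)
    ultimately show ?thesis by (simp only:)
  qed
  then show ?thesis
    using measurable_count_space_eq_countable[of UNIV "first_letters \<xi> n" M] by simp
qed

text \<open>
  Only finitely many coordinates matter for each \<open>n\<close>, so the words of independent letters capture
  the driving sequence on any probability space.
\<close>
lemma (in damaged_bits) prob_first_letters:
  "prob {\<omega> \<in> space M. first_letters \<xi> n \<omega> \<in> X} = measure_pmf.prob (replicate_pmf n P) X"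
proof -
  let ?D = "distr M (count_space UNIV) (first_letters \<xi> n)"
  have word: "prob {\<omega> \<in> space M. first_letters \<xi> n \<omega> = xs} = pmf (replicate_pmf n P) xs" for xs
  proof (cases "length xs = n \<and> 0 < n")
    case True
    have "{\<omega> \<in> space M. first_letters \<xi> n \<omega> = xs} = (\<Inter>i\<in>{1..n}. \<xi> i -` {xs ! (i - 1)} \<inter> space M)"
      using True by (auto simp: first_letters_eq_iff)
    then have "prob {\<omega> \<in> space M. first_letters \<xi> n \<omega> = xs} =
        prob (\<Inter>i\<in>{1..n}. \<xi> i -` {xs ! (i - 1)} \<inter> space M)"
      by simp
    also have "\<dots> = (\<Prod>i\<in>{1..n}. prob (\<xi> i -` {xs ! (i - 1)} \<inter> space M))"
      using True by (intro indep_varsD[OF indep]) auto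
    also have "\<dots> = (\<Prod>i\<in>{1..n}. pmf P (xs ! (i - 1)))"
    proof (intro prod.cong refl)
      fix i assume "i \<in> {1..n}"
      moreover have "\<xi> i -` {xs ! (i - 1)} \<inter> space M = {\<omega> \<in> space M. \<xi> i \<omega> = xs ! (i - 1)}"
        by auto
      ultimately show "prob (\<xi> i -` {xs ! (i - 1)} \<inter> space M) = pmf P (xs ! (i - 1))"
        using law[of i "xs ! (i - 1)"] by simp
    qed
    also have "\<dots> = (\<Prod>j<n. pmf P (xs ! j))"
      by (rule prod.reindex_bij_witness[of _ Suc "\<lambda>i. i - 1"]) auto
    also have "\<dots> = (\<Prod>x\<leftarrow>xs. pmf P x)"
      using True by (simp add: prod.list_conv_set_nth atLeast0LessThan)
    finally show ?thesis using True by (simp add: pmf_replicate_pmf)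
  next
    case False
    then show ?thesis
      by (auto simp: first_letters_eq_iff pmf_replicate_pmf prob_space)
  qed
  have D: "emeasure ?D X = emeasure M {\<omega> \<in> space M. first_letters \<xi> n \<omega> \<in> X}" for X
  proof -
    have "first_letters \<xi> n -` X \<inter> space M = {\<omega> \<in> space M. first_letters \<xi> n \<omega> \<in> X}" by auto
    then show ?thesis by (simp add: emeasure_distr[OF measurable_first_letters])
  qed
  have "?D = measure_pmf (replicate_pmf n P)"
  proof (rule measure_eqI_countable[of _ UNIV])
    fix xs
    show "emeasure ?D {xs} = emeasure (replicate_pmf n P) {xs}"
      unfolding D by (simp add: emeasure_eq_measure word emeasure_pmf_single)
  qed auto
  then show ?thesis using D[of X] by (simp add: measure_def)
qed

lemma db_state_eq_count: "db_state \<xi> n \<omega> k = min 2 (count (mset (first_letters \<xi> n \<omega>)) k)"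
  by (induction n) (auto simp: first_letters_def)

lemma db_ground_state_iff:
  "(\<forall>k\<ge>1. db_state \<xi> n \<omega> k \<in> {0, 2}) \<longleftrightarrow> first_letters \<xi> n \<omega> \<in> avoiding {1..} {}"
proof -
  have "min 2 c \<in> {0, 2} \<longleftrightarrow> c \<noteq> 1" for c :: nat
    by (auto simp: min_def)
  then show ?thesis
    unfolding db_state_eq_count avoiding_def by (simp add: Ball_def)
qed

lemma (in damaged_bits) nonreturning_prob_tendsto:
  "(\<lambda>n. measure_pmf.prob (replicate_pmf n P) (nonreturning {1..} 1 n)) \<longlonglongrightarrow>
    1 - prob {\<omega> \<in> space M. db_return_time \<xi> \<omega> < \<infinity>}"
proof -
  define E where "E n = {\<omega> \<in> space M. first_letters \<xi> n \<omega> \<in> nonreturning {1..} 1 n}" for n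
  have E: "E n = {\<omega> \<in> space M. \<forall>j\<in>{1..n}. first_letters \<xi> j \<omega> \<notin> avoiding {1..} {}}" for n
    unfolding E_def nonreturning_def by (auto simp: take_first_letters)
  have "E n = first_letters \<xi> n -` nonreturning {1..} 1 n \<inter> space M" for n
    by (auto simp: E_def)
  then have sets: "E n \<in> events" for n
    using measurable_sets[OF measurable_first_letters[of n]] by simp
  have "(\<lambda>n. prob (E n)) \<longlonglongrightarrow> prob (\<Inter>n. E n)"
    using sets by (intro finite_Lim_measure_decseq) (auto simp: decseq_def E)
  moreover have "(\<Inter>n. E n) = space M - {\<omega> \<in> space M. db_return_time \<xi> \<omega> < \<infinity>}"
  proof (intro equalityI subsetI)
    fix \<omega> assume \<omega>: "\<omega> \<in> (\<Inter>n. E n)"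
    have "first_letters \<xi> j \<omega> \<notin> avoiding {1..} {}" if "1 \<le> j" for j
    proof -
      have "\<omega> \<in> E j" using \<omega> by blast
      then show ?thesis unfolding E using that by simp
    qed
    moreover have "\<omega> \<in> space M" using \<omega> by (simp add: E_def)
    ultimately show "\<omega> \<in> space M - {\<omega> \<in> space M. db_return_time \<xi> \<omega> < \<infinity>}"
      unfolding db_return_time_finite_iff db_ground_state_iff by simp
  next
    fix \<omega> assume "\<omega> \<in> space M - {\<omega> \<in> space M. db_return_time \<xi> \<omega> < \<infinity>}"
    then show "\<omega> \<in> (\<Inter>n. E n)"
      unfolding E db_return_time_finite_iff db_ground_state_iff by simp
  qed
  ultimately show ?thesis
    by (simp only: E_def prob_first_letters prob_compl[OF db_return_event])
qed

section \<open>Geometrically decaying tails\<close>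

lemma exp_minus_two_le:
  fixes y :: real
  assumes "0 \<le> y" "y \<le> 1 / 2"
  shows "exp (- 2 * y) \<le> 1 - y"
proof -
  have "- 2 * y \<le> - y - 2 * y\<^sup>2"
    using mult_left_mono[OF assms(2,1)] by (simp add: power2_eq_square)
  also have "\<dots> \<le> ln (1 - y)"
    using assms by (rule ln_one_minus_pos_lower_bound)
  finally show ?thesis
    using assms by (subst (asm) ln_ge_iff) auto
qed

lemma summable_pmf_shift: "summable (\<lambda>j. pmf P (j + k :: nat))"
proof -
  have "(\<lambda>n. pmf P n * 1) sums measure_pmf.expectation P (\<lambda>_. 1)"
    by (rule sums_expectation_pmf_nat[where B=1]) simp
  then show ?thesis
    by (intro summable_ignore_initial_segment) (simp add: sums_iff)
qed

lemma tail_sum_eq_Suc: "tail_sum P k = pmf P (Suc k) + tail_sum P (Suc k)"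
  using suminf_split_head[OF summable_pmf_shift[of P "Suc k"]]
  by (simp add: tail_sum_def add_ac)

lemma tail_sum_nonneg: "0 \<le> tail_sum P k"
  unfolding tail_sum_def using summable_pmf_shift[of P "k + 1"]
  by (intro suminf_nonneg) (simp_all add: add_ac)

text \<open>
  Since \<open>p (k + 1) = Q k - Q (k + 1) \<ge> (1 - q) * Q k\<close>, the summand is at most
  \<open>t * (Q k - Q (k + 1)) * exp (- (1 - q) * t * Q k)\<close>: a lower Riemann sum for the integral of
  \<open>exp (- (1 - q) * s)\<close> over \<open>s \<ge> 0\<close> with nodes \<open>t * Q k\<close>, whatever the value of \<open>t\<close>.
\<close>
lemma geometric_tail_active_bits_le:
  fixes q t :: real
  assumes t: "0 \<le> t" and q: "q < 1" and ratio: "\<And>k. k \<ge> K \<Longrightarrow> tail_sum P (Suc k) \<le> q * tail_sum P k"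
  shows "(\<Sum>k\<in>{Suc K..<Suc N}. t * pmf P k * exp (- t * pmf P k)) \<le> 1 / (1 - q)"
proof (cases "K \<le> N")
  case False
  then show ?thesis using q by simp
next
  case True
  let ?Q = "tail_sum P" and ?r = "1 - q"
  have r: "0 < ?r" using q by simp
  have bit: "t * pmf P (Suc k) * exp (- t * pmf P (Suc k)) \<le>
      1 / ?r * (exp (- ?r * (t * ?Q (Suc k))) - exp (- ?r * (t * ?Q k)))" if k: "K \<le> k" for k
  proof -
    define a b where "a = t * ?Q (Suc k)" and "b = t * ?Q k"
    have ab: "t * pmf P (Suc k) = b - a"
      by (simp add: a_def b_def tail_sum_eq_Suc[of P k] algebra_simps)
    have "?r * ?Q k \<le> pmf P (Suc k)"
      using ratio[OF k] tail_sum_eq_Suc[of P k] by (simp add: algebra_simps)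
    then have rb: "?r * b \<le> b - a"
      using t mult_left_mono[of "?r * ?Q k" "pmf P (Suc k)" t] unfolding ab[symmetric]
      by (simp add: b_def algebra_simps)
    have "0 \<le> b - a" unfolding ab[symmetric] using t by simp
    \<comment> \<open>comparison of the rectangle with the integral of \<open>exp (- ?r * s)\<close> over \<open>[a, b]\<close>\<close>
    have "?r * ((b - a) * exp (- (b - a))) \<le> ?r * ((b - a) * exp (- ?r * b))"
    proof (intro mult_left_mono)
      show "exp (- (b - a)) \<le> exp (- ?r * b)"
        using rb by (simp only: exp_le_cancel_iff mult_minus_left neg_le_iff_le)
    qed (use r \<open>0 \<le> b - a\<close> in auto)
    also have "\<dots> = (?r * (b - a)) * exp (- ?r * b)" by simp
    also have "\<dots> \<le> (exp (?r * (b - a)) - 1) * exp (- ?r * b)"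
    proof (rule mult_right_mono)
      show "?r * (b - a) \<le> exp (?r * (b - a)) - 1"
        using exp_ge_add_one_self[of "?r * (b - a)"] by linarith
    qed simp
    also have "\<dots> = exp (- ?r * a) - exp (- ?r * b)"
      by (simp add: left_diff_distrib algebra_simps flip: exp_add)
    finally have "(b - a) * exp (- (b - a)) \<le> 1 / ?r * (exp (- ?r * a) - exp (- ?r * b))"
      using r by (simp add: field_simps)
    then show ?thesis using ab unfolding a_def b_def by simp
  qed
  have "(\<Sum>k\<in>{Suc K..<Suc N}. t * pmf P k * exp (- t * pmf P k)) =
      (\<Sum>k\<in>{K..<N}. t * pmf P (Suc k) * exp (- t * pmf P (Suc k)))"
    by (rule sum.shift_bounds_Suc_ivl)
  also have "\<dots> \<le> (\<Sum>k\<in>{K..<N}. 1 / ?r * (exp (- ?r * (t * ?Q (Suc k))) - exp (- ?r * (t * ?Q k))))"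
    by (intro sum_mono bit) auto
  also have "\<dots> = 1 / ?r * (exp (- ?r * (t * ?Q N)) - exp (- ?r * (t * ?Q K)))"
    unfolding sum_distrib_left[symmetric] by (subst sum_Suc_diff'[OF True]) simp
  also have "\<dots> \<le> 1 / ?r * (1 - 0)"
  proof (intro mult_left_mono diff_mono)
    have "0 \<le> ?r * (t * ?Q N)" using r t tail_sum_nonneg[of P N] by simp
    then show "exp (- ?r * (t * ?Q N)) \<le> 1"
      by (simp only: mult_minus_left exp_le_one_iff neg_le_0_iff_le)
  qed (use r in auto)
  finally show ?thesis by simp
qed

text \<open>
  The first \<open>K\<close> bits, about which nothing is known, contribute at most \<open>1/2\<close> each to the sum of
  the \<open>t * p k * exp (- t * p k)\<close>. No factor of the product is below \<open>1/2\<close>, so the bound on this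
  sum passes to the product by \<open>exp_minus_two_le\<close>.
\<close>
lemma geometric_tail_prod_ge:
  fixes q :: real
  assumes q: "q < 1" and ratio: "\<And>k. k \<ge> K \<Longrightarrow> tail_sum P (Suc k) \<le> q * tail_sum P k"
    and A: "finite A" "A \<subseteq> {1..}" and t: "0 \<le> t"
  shows "exp (- 2 * (real K / 2 + 1 / (1 - q))) \<le> (\<Prod>k\<in>A. 1 - t * pmf P k * exp (- t * pmf P k))"
proof -
  let ?y = "\<lambda>k. t * pmf P k * exp (- t * pmf P k)"
  have y: "0 \<le> ?y k" "?y k \<le> 1 / 2" for k
    using xexp_minus_bounds[of "t * pmf P k"] t by simp_all
  obtain N where N: "A \<subseteq> {..N}" using A(1) finite_nat_iff_bounded_le by blast
  have "sum ?y A \<le> sum ?y ({1..K} \<union> {Suc K..<Suc N})"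
  proof (rule sum_mono2)
    show "A \<subseteq> {1..K} \<union> {Suc K..<Suc N}"
      using A(2) N by (force simp: subset_iff)
  qed (use t in auto)
  also have "\<dots> = sum ?y {1..K} + sum ?y {Suc K..<Suc N}"
    by (rule sum.union_disjoint) auto
  also have "\<dots> \<le> real (card {1..K}) * (1 / 2) + 1 / (1 - q)"
    by (intro add_mono sum_bounded_above y(2) geometric_tail_active_bits_le t q ratio)
  finally have "sum ?y A \<le> real K / 2 + 1 / (1 - q)" by simp
  then have "exp (- 2 * (real K / 2 + 1 / (1 - q))) \<le> exp (- 2 * sum ?y A)" by simp
  also have "\<dots> = (\<Prod>k\<in>A. exp (- 2 * ?y k))"
    by (simp add: sum_distrib_left exp_sum[OF A(1)])
  also have "\<dots> \<le> (\<Prod>k\<in>A. 1 - ?y k)"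
    by (intro prod_mono conjI exp_minus_two_le y) simp
  finally show ?thesis .
qed

lemma (in damaged_bits) db_recurrent_of_limsup_tail_ratio:
  assumes lim: "limsup (\<lambda>k. ereal (tail_sum P (k + 1) / tail_sum P k)) = ereal p" and p: "p < 1"
  shows "db_recurrent M \<xi>"
proof -
  obtain q where q: "p < q" "q < 1" using dense[OF p] by blast
  have "limsup (\<lambda>k. ereal (tail_sum P (k + 1) / tail_sum P k)) < ereal q"
    unfolding lim using q by simp
  then have "\<forall>\<^sub>F k in sequentially. ereal (tail_sum P (k + 1) / tail_sum P k) < ereal q"
    by (rule Limsup_lessD)
  then obtain K where K: "\<And>k. k \<ge> K \<Longrightarrow> tail_sum P (k + 1) / tail_sum P k < q"
    unfolding eventually_sequentially by auto
  have ratio: "tail_sum P (Suc k) \<le> q * tail_sum P k" if "k \<ge> K" for k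
  proof (cases "tail_sum P k = 0")
    case True
    then have "tail_sum P (Suc k) = 0"
      using tail_sum_eq_Suc[of P k] tail_sum_nonneg[of P "Suc k"] pmf_nonneg[of P "Suc k"] by linarith
    with True show ?thesis by simp
  next
    case False
    then have "0 < tail_sum P k" using tail_sum_nonneg[of P k] by simp
    with K[OF that] show ?thesis by (simp add: divide_less_eq)
  qed
  let ?c = "exp (- 2 * (real K / 2 + 1 / (1 - q)))"
  have "\<exists>\<^sub>F n in sequentially. ?c / 2 \<le> measure_pmf.prob (replicate_pmf n P) (avoiding {1..} {})"
    by (rule prob_avoiding_frequently_ge) (simp_all only: exp_gt_zero geometric_tail_prod_ge q ratio)
  then have "(\<lambda>n. measure_pmf.prob (replicate_pmf n P) (nonreturning {1..} 1 n)) \<longlonglongrightarrow> 0"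
    by (rule nonreturning_prob_tendsto_0[rotated]) simp
  then have "1 - prob {\<omega> \<in> space M. db_return_time \<xi> \<omega> < \<infinity>} = 0"
    using nonreturning_prob_tendsto LIMSEQ_unique by blast
  then show ?thesis by (simp add: db_recurrent_def)
qed

section \<open>Stretched exponential tails\<close>

lemma asymp_equiv_two_sided:
  fixes f g :: "nat \<Rightarrow> real"
  assumes "f \<sim>[at_top] g" "\<And>k. 0 < g k"
  shows "\<forall>\<^sub>F k in sequentially. g k / 2 \<le> f k \<and> f k \<le> 2 * g k"
proof -
  have "g k \<noteq> 0" for k using assms(2)[of k] by simp
  then have "(\<lambda>k. f k / g k) \<longlonglongrightarrow> 1"
    using asymp_equivD[OF assms(1)] by simp
  then have "\<forall>\<^sub>F k in sequentially. 1 / 2 < f k / g k \<and> f k / g k < 2"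
    by (intro eventually_conj order_tendstoD) auto
  then show ?thesis
    by eventually_elim (use assms(2) in \<open>auto simp: less_divide_eq divide_less_eq intro: less_imp_le\<close>)
qed

lemma card_nats_between_ge:
  fixes L w :: real
  assumes "0 \<le> L"
  shows "finite {k. L \<le> real k \<and> real k \<le> L + w}" "w - 1 \<le> real (card {k. L \<le> real k \<and> real k \<le> L + w})"
proof -
  let ?A = "{k. L \<le> real k \<and> real k \<le> L + w}"
  show fin: "finite ?A"
    by (rule finite_subset[of _ "{..nat \<lfloor>L + w\<rfloor>}"]) (auto simp: le_nat_floor)
  show "w - 1 \<le> real (card ?A)"
  proof (cases "w \<le> 1")
    case False
    have "{nat \<lceil>L\<rceil>..nat \<lfloor>L + w\<rfloor>} \<subseteq> ?A"
      using assms False by (auto simp: nat_le_iff le_nat_iff ceiling_le_iff le_floor_iff)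
    then have "card {nat \<lceil>L\<rceil>..nat \<lfloor>L + w\<rfloor>} \<le> card ?A"
      by (intro card_mono fin)
    moreover have "real (nat \<lceil>L\<rceil>) \<le> L + 1" "L + w - 1 \<le> real (nat \<lfloor>L + w\<rfloor>)"
      using assms False by linarith+
    ultimately show ?thesis by simp
  qed simp
qed

text \<open>
  With \<open>u = ln n\<close>, the point \<open>L\<close> is where \<open>n * exp (- \<alpha> * L powr \<gamma>) = 1\<close>. By concavity
  \<open>x powr \<gamma>\<close> grows by at most \<open>L powr (\<gamma> - 1) * w = 1 / \<alpha>\<close> on a window of length
  \<open>w = L powr (1 - \<gamma>) / \<alpha>\<close>, so \<open>n * p k\<close> stays of order one there.
\<close>
lemma stretched_exponential_window:
  fixes \<alpha> \<gamma> u x :: real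
  assumes \<alpha>: "0 < \<alpha>" and \<gamma>: "0 < \<gamma>" "\<gamma> < 1" and u: "0 < u"
  defines "L \<equiv> (u / \<alpha>) powr (1 / \<gamma>)" and "w \<equiv> (u / \<alpha>) powr ((1 - \<gamma>) / \<gamma>) / \<alpha>"
  assumes x: "L \<le> x" "x \<le> L + w"
  shows "u \<le> \<alpha> * x powr \<gamma>" "\<alpha> * x powr \<gamma> \<le> u + 1"
proof -
  have L: "0 < L" using \<alpha> u by (simp add: L_def)
  have Lg: "L powr \<gamma> = u / \<alpha>" using \<alpha> \<gamma> u by (simp add: L_def powr_powr)
  have "w = L powr (1 - \<gamma>) / \<alpha>" by (simp add: w_def L_def powr_powr)
  also have "L powr (1 - \<gamma>) = L / L powr \<gamma>" using L by (simp add: powr_diff)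
  finally have w: "w / L = 1 / u" using L \<alpha> u by (simp add: Lg field_simps)
  have "0 \<le> w" using \<alpha> by (simp add: w_def)
  have "L powr \<gamma> \<le> x powr \<gamma>" using x L \<gamma> by (intro powr_mono2) auto
  then show "u \<le> \<alpha> * x powr \<gamma>" using Lg \<alpha> by (simp add: field_simps)
  have "L * (1 + w / L) = L + w" using L by (simp add: field_simps)
  then have "x powr \<gamma> \<le> (L * (1 + w / L)) powr \<gamma>"
    using x L \<gamma> by (intro powr_mono2) auto
  also have "\<dots> = (u / \<alpha>) * (1 + 1 / u) powr \<gamma>"
    using L u unfolding w by (simp add: powr_mult Lg)
  also have "\<dots> \<le> (u / \<alpha>) * (1 + 1 / u) powr 1"
    using \<gamma> u \<alpha> by (intro mult_left_mono powr_mono) auto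
  also have "\<dots> = (u + 1) / \<alpha>" using u \<alpha> by (simp add: field_simps)
  finally show "\<alpha> * x powr \<gamma> \<le> u + 1" using \<alpha> by (simp add: field_simps)
qed

text \<open>
  Each bit in the window contributes at least a constant, and the window has length of order
  \<open>(ln n) powr ((1 - \<gamma>) / \<gamma>)\<close> with exponent larger than one, which beats every multiple of
  \<open>ln n\<close>. The factor \<open>3\<close> makes the return probabilities \<open>O(n powr (- 2))\<close> after the loss of a
  factor \<open>n\<close> in \<open>prob_avoiding_le\<close>.
\<close>
lemma stretched_exponential_active_bits:
  fixes C \<alpha> \<gamma> :: real
  assumes C: "0 < C" and \<alpha>: "0 < \<alpha>" and \<gamma>: "0 < \<gamma>" "\<gamma> < 1 / 2"
    and asymp: "pmf P \<sim>[at_top] (\<lambda>k. C * exp (- \<alpha> * real k powr \<gamma>))"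
  shows "\<forall>\<^sub>F n in sequentially. \<exists>A. finite A \<and> A \<subseteq> {1..} \<and>
    3 * ln (real n) \<le> (\<Sum>k\<in>A. real n * pmf P k * exp (- real n * pmf P k))"
proof -
  let ?g = "\<lambda>k. C * exp (- \<alpha> * real k powr \<gamma>)"
  obtain K where K: "\<And>k. k \<ge> K \<Longrightarrow> ?g k / 2 \<le> pmf P k \<and> pmf P k \<le> 2 * ?g k"
    using asymp_equiv_two_sided[OF asymp] C unfolding eventually_sequentially by auto
  define L where "L u = (u / \<alpha>) powr (1 / \<gamma>)" for u
  define w where "w u = (u / \<alpha>) powr ((1 - \<gamma>) / \<gamma>) / \<alpha>" for u
  \<comment> \<open>On the window \<open>n * p k\<close> lies between \<open>C / (2 * e)\<close> and \<open>2 * C\<close>.\<close>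
  define c where "c = C / 2 * exp (- 1) * exp (- (2 * C))"
  have c: "0 < c" using C by (simp add: c_def)
  define d where "d = (1 - \<gamma>) / \<gamma> - 1"
  have d: "0 < d" using \<gamma> by (simp add: d_def field_simps)
  have wd: "w u = (u / \<alpha>) powr (1 + d) / \<alpha>" for u by (simp add: w_def d_def)
  have "\<forall>\<^sub>F u in at_top. 3 * u \<le> c * (w u - 1)"
    unfolding wd using \<alpha> c d by real_asymp
  moreover have "filterlim L at_top at_top"
    unfolding L_def using \<alpha> \<gamma> by real_asymp
  then have "\<forall>\<^sub>F u in at_top. real K + 1 \<le> L u"
    by (simp add: filterlim_at_top)
  ultimately have "\<forall>\<^sub>F u in at_top. 0 < u \<and> real K + 1 \<le> L u \<and> 3 * u \<le> c * (w u - 1)"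
    using eventually_gt_at_top[of 0] by eventually_elim auto
  moreover have "filterlim (\<lambda>n. ln (real n)) at_top sequentially" by real_asymp
  ultimately have "\<forall>\<^sub>F n in sequentially. 0 < ln (real n) \<and> real K + 1 \<le> L (ln (real n)) \<and>
      3 * ln (real n) \<le> c * (w (ln (real n)) - 1)"
    by (rule eventually_compose_filterlim)
  then show ?thesis
    using eventually_gt_at_top[of 0]
  proof eventually_elim
    case (elim n)
    define u where "u = ln (real n)"
    have u: "0 < u" "real K + 1 \<le> L u" "3 * u \<le> c * (w u - 1)" and n: "0 < n"
      using elim by (simp_all add: u_def)
    have nu: "real n = exp u" using n by (simp add: u_def)
    let ?A = "{k. L u \<le> real k \<and> real k \<le> L u + w u}"
    have bit: "c \<le> real n * pmf P k * exp (- real n * pmf P k)" if k: "k \<in> ?A" for k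
    proof -
      have "K \<le> k" using k u(2) by simp
      note p = K[OF this]
      have e: "u \<le> \<alpha> * real k powr \<gamma>" "\<alpha> * real k powr \<gamma> \<le> u + 1"
        using stretched_exponential_window[OF \<alpha> \<gamma>(1) _ u(1), of "real k"] k \<gamma>
        by (simp_all add: L_def w_def)
      have ng: "real n * ?g k = C * exp (u - \<alpha> * real k powr \<gamma>)"
        by (simp add: nu exp_diff exp_minus field_simps)
      have "C * exp (- 1) \<le> real n * ?g k"
        unfolding ng using C e by (intro mult_left_mono) auto
      then have lo: "C / 2 * exp (- 1) \<le> real n * pmf P k"
        using mult_left_mono[OF conjunct1[OF p], of "real n"] by simp
      have "real n * ?g k \<le> C * 1"
        unfolding ng using C e by (intro mult_left_mono) auto
      then have "real n * pmf P k \<le> 2 * C"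
        using mult_left_mono[OF conjunct2[OF p], of "real n"] by simp
      then have hi: "exp (- (2 * C)) \<le> exp (- real n * pmf P k)" by simp
      show ?thesis
        unfolding c_def by (rule mult_mono[OF lo hi]) simp_all
    qed
    have fin: "finite ?A" and card: "w u - 1 \<le> real (card ?A)"
      using card_nats_between_ge[of "L u" "w u"] u(2) by auto
    have "3 * u \<le> c * (w u - 1)" by (rule u)
    also have "\<dots> \<le> c * real (card ?A)" using c card by (intro mult_left_mono) auto
    also have "\<dots> \<le> (\<Sum>k\<in>?A. real n * pmf P k * exp (- real n * pmf P k))"
      using sum_bounded_below[of ?A c] bit by (simp add: mult.commute)
    finally show ?case
      using fin u(2) by (intro exI[of _ ?A]) (auto simp: u_def)
  qed
qed

lemma (in damaged_bits) db_transient_of_stretched_exponential: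
  fixes C \<alpha> \<gamma> :: real
  assumes "0 < C" "0 < \<alpha>" "0 < \<gamma>" "\<gamma> < 1 / 2"
    and "pmf P \<sim>[at_top] (\<lambda>k. C * exp (- \<alpha> * real k powr \<gamma>))"
  shows "db_transient M \<xi>"
proof -
  let ?q = "\<lambda>n. measure_pmf.prob (replicate_pmf n P) (avoiding {1..} {})"
  have "\<forall>\<^sub>F n in sequentially. norm (?q n) \<le> exp 1 * inverse (real n ^ 2)"
    using stretched_exponential_active_bits[OF assms] eventually_ge_at_top[of 1]
  proof eventually_elim
    case (elim n)
    then obtain A where A: "finite A" "A \<subseteq> {1..}"
        "3 * ln (real n) \<le> (\<Sum>k\<in>A. real n * pmf P k * exp (- real n * pmf P k))"
      by blast
    have "?q n \<le> exp 1 * real n * exp (- (\<Sum>k\<in>A. real n * pmf P k * exp (- real n * pmf P k)))"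
      using elim A by (intro prob_avoiding_le) auto
    also have "\<dots> \<le> exp 1 * real n * exp (- (3 * ln (real n)))"
      using A(3) by (intro mult_left_mono) auto
    also have "exp (- (3 * ln (real n))) = inverse (real n ^ 3)"
      using elim exp_of_nat_mult[of 3 "ln (real n)"] by (simp add: exp_minus)
    also have "exp 1 * real n * inverse (real n ^ 3) = exp 1 * inverse (real n ^ 2)"
      using elim by (simp add: field_simps power3_eq_cube power2_eq_square)
    finally show ?case by simp
  qed
  then have "summable ?q"
    by (rule summable_comparison_test_ev) (intro summable_mult inverse_power_summable, simp)
  then obtain \<delta> where \<delta>: "0 < \<delta>"
      "\<And>n. \<delta> \<le> measure_pmf.prob (replicate_pmf n P) (nonreturning {1..} 1 n)"
    by (rule nonreturning_prob_ge) blast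
  have "\<delta> \<le> 1 - prob {\<omega> \<in> space M. db_return_time \<xi> \<omega> < \<infinity>}"
    using \<delta>(2) by (intro LIMSEQ_le_const[OF nonreturning_prob_tendsto]) auto
  with \<delta>(1) show ?thesis by (simp add: db_transient_def db_recurrent_def)
qed

theorem theorem2p4:
  fixes M :: "'a measure" and P :: "nat pmf" and \<xi> :: "nat \<Rightarrow> 'a \<Rightarrow> nat"
  assumes model: "damaged_bits M P \<xi>"
    and nonincreasing: "\<forall>k\<ge>1. pmf P (k + 1) \<le> pmf P k"
    and unbounded_support: "\<not> bdd_above (set_pmf P)"
  shows "(\<forall>p::real. limsup (\<lambda>k. ereal (tail_sum P (k + 1) / tail_sum P k)) = ereal p \<and> p < 1
            \<longrightarrow> db_recurrent M \<xi>) \<and>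
         (\<forall>C \<alpha> \<gamma> :: real. C > 0 \<and> \<alpha> > 0 \<and> \<gamma> \<in> {0<..<1/2} \<and>
            pmf P \<sim>[at_top] (\<lambda>k. C * exp (- \<alpha> * real k powr \<gamma>))
            \<longrightarrow> db_transient M \<xi>)"
proof -
  interpret damaged_bits M P \<xi> by (rule model)
  show ?thesis
    using db_recurrent_of_limsup_tail_ratio db_transient_of_stretched_exponential by auto
qed

end
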